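(* Assume that $P(x,y)>0$ for all $x,y\in X$ and that there is a constant $C_*\ge 1$ with $P_2(x,y)\le C_*P(x,y)$ for all $x,y\in X$; that $\sup_{x,y\in X}P(x,y)/\mu(y)<\infty$; and that the potential $V$ is confining. Let $\kappa:\mathbb N\to[0,\infty)$ be a given rate function, let $(A_n)$ be an arbitrary sequence of subsets of $X$, and $n_0\in\mathbb N$. Consider the following two statements: (a) There exists a constant $C_1>0$ such that for all $n\ge n_0$, $$\sup_{x\in A_n}\ \sup_{\|f\|_{\ell^1(\nu)}\le1}\big|\mathcal Q_nf(x)-\bar\nu(f)\big|\le C_1\,\kappa(n).$$ (b) There exists a constant $C_2>0$ such that for all $n\ge n_0$, $$\sup_{x\in A_n}\ \sup_{\|f\|_{\ell^1(m)}\le1}\left|\frac{\mathcal U_nf(x)}{\mathcal U_n\mathbf 1(x)}-m(f)\right|\le C_2\,\kappa(n).$$ Then (a) implies (b). If, in addition, $C_3:=\sup_{n\ge n_0}C_2\kappa(n)<1$ (with $C_2$ the constant in (b)), then (b) implies (a). Moreover, the same implications remain true if $\mathcal Q_n$ is replaced with $\widehat{\mathcal Q}_n$ in (a), and $\mathcal U_n$, $m$ with $\widehat{\mathcal U}_n$, $\widehat m$ in (b).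
   Context: $X$ is a countably infinite set, $\mathbb N=\{1,2,\dots\}$, $\mathbf 1$ is the constant function $1$. $P:X\times X\to[0,1]$ is a (sub-)probability kernel, i.e. $\sum_{y\in X}P(x,y)\le1$ for all $x$. It is assumed throughout that there are a (sub-)probability kernel $\widehat P:X\times X\to[0,1]$ and a measure $\mu:X\to(0,\infty)$ with $\mu(x)P(x,y)=\mu(y)\widehat P(y,x)$ for all $x,y\in X$. Put $P_2(x,y)=\sum_{z\in X}P(x,z)P(z,y)$. A potential is a function $V:X\to(0,\infty)$ with $\inf_{x\in X}V(x)>0$ (standing assumption). It is confining if for every $M\in\mathbb N$ there is a finite set $B_M\subset X$ with $V(x)\ge M$ for all $x\in X\setminus B_M$. Let $\mathcal U f(x)=\frac1{V(x)}\sum_{y}P(x,y)f(y)$ and $\widehat{\mathcal U}f(x)=\sum_y\widehat P(x,y)\frac1{V(y)}f(y)$; these are mutually adjoint on $\ell^2(\mu)$. Let $\mathcal U_n=\mathcal U^n$, $\widehat{\mathcal U}_n=\widehat{\mathcal U}^n$. Under the hypotheses of the claim, $\mathcal U,\widehat{\mathcal U}$ are compact on $\ell^2(\mu)$ and $\lambda_0:=\sup_{\lambda\in\sigma(\mathcal U)}|\lambda|=\sup_{\lambda\in\sigma(\widehat{\mathcal U})}|\lambda|>0$ is a simple eigenvalue of both; $\varphi_0,\widehat\varphi_0$ denote the corresponding strictly positive eigenfunctions, $\mathcal U\varphi_0=\lambda_0\varphi_0$, $\widehat{\mathcal U}\widehat\varphi_0=\lambda_0\widehat\varphi_0$, normalized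 by $\|\varphi_0\|_{\ell^2(\mu)}=\|\widehat\varphi_0\|_{\ell^2(\mu)}=1$. Moreover $\varphi_0,\widehat\varphi_0\in\ell^1(\mu)\cap\ell^\infty(\mu)$. Let $\nu(x)=\varphi_0(x)\widehat\varphi_0(x)\mu(x)$, a finite measure with total mass $\|\nu\|=\sum_x\nu(x)$, and $\bar\nu(f)=\frac1{\|\nu\|}\sum_yf(y)\nu(y)$. The intrinsic semigroups are $\mathcal Q_nf=\lambda_0^{-n}\varphi_0^{-1}\,\mathcal U_n(f\varphi_0)$ and $\widehat{\mathcal Q}_nf=\lambda_0^{-n}\widehat\varphi_0^{-1}\,\widehat{\mathcal U}_n(f\widehat\varphi_0)$. The probability measures $m,\widehat m$ are $m(x)=\widehat\varphi_0(x)\mu(x)/\|\widehat\varphi_0\|_{\ell^1(\mu)}$ and $\widehat m(x)=\varphi_0(x)\mu(x)/\|\varphi_0\|_{\ell^1(\mu)}$, with $m(f)=\sum_xf(x)m(x)$ and similarly for $\widehat m$. *)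

theory Defs
  imports "HOL-Analysis.Analysis"
begin

text \<open>
  The countable state space is a type. Kernels, potentials and measures on it are plain real
  functions (a measure is identified with its point masses), and sums over the state space are
  unordered sums \<^const>\<open>infsum\<close>. Since \<^const>\<open>infsum\<close> returns 0 for families
  that are not summable, summability is required explicitly in the definitions of kernels and of
  the weighted \<open>\<ell>\<^sup>p\<close> spaces.
\<close>

definition subprob_kernel :: "('a \<Rightarrow> 'a \<Rightarrow> real) \<Rightarrow> bool" where
  "subprob_kernel P \<longleftrightarrow>
     (\<forall>x y. P x y \<in> {0..1}) \<and>
     (\<forall>x. (\<lambda>y. P x y) summable_on UNIV \<and> (\<Sum>\<^sub>\<infinity>y. P x y) \<le> 1)"

definition kernel_sq :: "('a \<Rightarrow> 'a \<Rightarrow> real) \<Rightarrow> 'a \<Rightarrow> 'a \<Rightarrow> real" where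
  "kernel_sq P x y = (\<Sum>\<^sub>\<infinity>z. P x z * P z y)"

definition potential :: "('a \<Rightarrow> real) \<Rightarrow> bool" where
  "potential V \<longleftrightarrow> (\<forall>x. V x > 0) \<and> (INF x. V x) > 0"

definition confining :: "('a \<Rightarrow> real) \<Rightarrow> bool" where
  "confining V \<longleftrightarrow> (\<forall>M::nat. M \<ge> 1 \<longrightarrow> (\<exists>B. finite B \<and> (\<forall>x. x \<notin> B \<longrightarrow> V x \<ge> real M)))"

text \<open>
  The operators are polymorphic in the scalars: they are used on complex-valued functions
  for the spectrum and on real-valued functions everywhere else.
\<close>

definition fk_op ::
  "('a \<Rightarrow> 'a \<Rightarrow> real) \<Rightarrow> ('a \<Rightarrow> real) \<Rightarrow> ('a \<Rightarrow> 'b::banach) \<Rightarrow> 'a \<Rightarrow> 'b" where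
  "fk_op P V f x = (1 / V x) *\<^sub>R (\<Sum>\<^sub>\<infinity>y. P x y *\<^sub>R f y)"

definition fk_dual_op ::
  "('a \<Rightarrow> 'a \<Rightarrow> real) \<Rightarrow> ('a \<Rightarrow> real) \<Rightarrow> ('a \<Rightarrow> 'b::banach) \<Rightarrow> 'a \<Rightarrow> 'b" where
  "fk_dual_op P' V f x = (\<Sum>\<^sub>\<infinity>y. (P' x y * (1 / V y)) *\<^sub>R f y)"

definition l2_space :: "('a \<Rightarrow> real) \<Rightarrow> ('a \<Rightarrow> 'b::real_normed_vector) set" where
  "l2_space \<mu> = {f. (\<lambda>x. (norm (f x))\<^sup>2 * \<mu> x) summable_on UNIV}"

definition l2_norm :: "('a \<Rightarrow> real) \<Rightarrow> ('a \<Rightarrow> 'b::real_normed_vector) \<Rightarrow> real" where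
  "l2_norm \<mu> f = sqrt (\<Sum>\<^sub>\<infinity>x. (norm (f x))\<^sup>2 * \<mu> x)"

text \<open>
  Spectrum on the complex space \<open>\<ell>\<^sup>2(\<mu>)\<close>: the second conjunct below says that the
  inverse of \<open>\<lambda> I - T\<close> is bounded. As \<open>\<mu>\<close> is strictly positive, no identification
  modulo null sets is needed.
\<close>

definition l2_resolvent_set ::
  "('a \<Rightarrow> real) \<Rightarrow> (('a \<Rightarrow> complex) \<Rightarrow> 'a \<Rightarrow> complex) \<Rightarrow> complex set" where
  "l2_resolvent_set \<mu> T =
     {l. bij_betw (\<lambda>f x. l * f x - T f x) (l2_space \<mu>) (l2_space \<mu>) \<and>
         (\<exists>K. \<forall>f\<in>l2_space \<mu>. l2_norm \<mu> f \<le> K * l2_norm \<mu> (\<lambda>x. l * f x - T f x))}"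

definition l2_spectrum ::
  "('a \<Rightarrow> real) \<Rightarrow> (('a \<Rightarrow> complex) \<Rightarrow> 'a \<Rightarrow> complex) \<Rightarrow> complex set" where
  "l2_spectrum \<mu> T = - l2_resolvent_set \<mu> T"

definition l2_spectral_radius ::
  "('a \<Rightarrow> real) \<Rightarrow> (('a \<Rightarrow> complex) \<Rightarrow> 'a \<Rightarrow> complex) \<Rightarrow> real" where
  "l2_spectral_radius \<mu> T = (SUP l\<in>l2_spectrum \<mu> T. norm l)"

definition normalized_ground_state ::
  "('a \<Rightarrow> real) \<Rightarrow> (('a \<Rightarrow> real) \<Rightarrow> 'a \<Rightarrow> real) \<Rightarrow> real \<Rightarrow> ('a \<Rightarrow> real) \<Rightarrow> bool" where
  "normalized_ground_state \<mu> T l \<phi> \<longleftrightarrow>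
     (\<forall>x. \<phi> x > 0) \<and> \<phi> \<in> l2_space \<mu> \<and> l2_norm \<mu> \<phi> = 1 \<and> (\<forall>x. T \<phi> x = l * \<phi> x)"

definition l1_norm :: "('a \<Rightarrow> real) \<Rightarrow> ('a \<Rightarrow> real) \<Rightarrow> real" where
  "l1_norm w f = (\<Sum>\<^sub>\<infinity>x. \<bar>f x\<bar> * w x)"

definition l1_unit_ball :: "('a \<Rightarrow> real) \<Rightarrow> ('a \<Rightarrow> real) set" where
  "l1_unit_ball w = {f. (\<lambda>x. \<bar>f x\<bar> * w x) summable_on UNIV \<and> l1_norm w f \<le> 1}"

definition wsum :: "('a \<Rightarrow> real) \<Rightarrow> ('a \<Rightarrow> real) \<Rightarrow> real" where
  "wsum w f = (\<Sum>\<^sub>\<infinity>x. f x * w x)"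

definition wmean :: "('a \<Rightarrow> real) \<Rightarrow> ('a \<Rightarrow> real) \<Rightarrow> real" where
  "wmean w f = wsum w f / (\<Sum>\<^sub>\<infinity>x. w x)"

definition intrinsic_op ::
  "(('a \<Rightarrow> real) \<Rightarrow> 'a \<Rightarrow> real) \<Rightarrow> real \<Rightarrow> ('a \<Rightarrow> real) \<Rightarrow> nat \<Rightarrow> ('a \<Rightarrow> real) \<Rightarrow> 'a \<Rightarrow> real" where
  "intrinsic_op T l \<phi> n f x = inverse (l ^ n) * inverse (\<phi> x) * (T ^^ n) (\<lambda>y. f y * \<phi> y) x"

definition normalized_op ::
  "(('a \<Rightarrow> real) \<Rightarrow> 'a \<Rightarrow> real) \<Rightarrow> nat \<Rightarrow> ('a \<Rightarrow> real) \<Rightarrow> 'a \<Rightarrow> real" where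
  "normalized_op T n f x = (T ^^ n) f x / (T ^^ n) (\<lambda>_. 1) x"

text \<open>
  The supremum is taken in \<open>[0, \<infinity>]\<close>, so it is meaningful without a boundedness
  proviso and equals 0 for empty \<open>S\<close>.
\<close>

definition sup_dev ::
  "'a set \<Rightarrow> ('a \<Rightarrow> real) \<Rightarrow> (('a \<Rightarrow> real) \<Rightarrow> 'a \<Rightarrow> real) \<Rightarrow> (('a \<Rightarrow> real) \<Rightarrow> real) \<Rightarrow> ennreal" where
  "sup_dev S w T L = (SUP x\<in>S. SUP f\<in>l1_unit_ball w. ennreal \<bar>T f x - L f\<bar>)"

end

theory Submission
  imports Defs
begin

text \<open>
  Write \<open>T\<close> for either operator, \<open>\<phi>\<close> for its ground state and \<open>w\<close> for
  the ground state of the adjoint times \<open>\<mu>\<close>. With \<open>D h = T\<^sup>n h / (\<rho>\<^sup>n \<phi>)\<close>,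
  statement (a) says that \<open>D h\<close> is close to \<open>w(h) / w(\<phi>)\<close> and statement (b) that
  \<open>D h / D 1\<close> is close to \<open>w(h) / w(1)\<close>, in both cases uniformly for \<open>h\<close> in the
  unit ball of \<open>\<ell>\<^sup>1(w)\<close>. Taking \<open>h = 1\<close> in (a) and using \<open>D 1 \<ge> 1 / sup \<phi>\<close>
  gives (b); taking \<open>h = \<phi>\<close> in (b), where \<open>D \<phi> = 1\<close>, controls \<open>D 1\<close> and
  gives (a). What remains is that the ground states are bounded and lie in \<open>\<ell>\<^sup>1(\<mu>)\<close>.
  The latter follows from an inequality \<open>\<psi> \<le> g + P \<psi> / 2\<close> with \<open>g\<close> in
  \<open>\<ell>\<^sup>1(\<mu>)\<close>, which holds because \<open>V\<close> is large off a finite set.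
\<close>

section \<open>Unordered sums of nonnegative reals\<close>

text \<open>Nonnegativity turns iterated summability in one order into summability over the product,
  from which the other order and the interchange follow. Summability is concluded explicitly because
  a divergent \<open>infsum\<close> would silently be 0.\<close>

lemma tonelli_infsum:
  fixes f :: "'a \<Rightarrow> 'b \<Rightarrow> real"
  assumes nonneg: "\<And>x y. f x y \<ge> 0"
    and inner: "\<And>x. f x summable_on UNIV"
    and outer: "(\<lambda>x. \<Sum>\<^sub>\<infinity>y. f x y) summable_on UNIV"
  shows "(\<lambda>x. f x y) summable_on UNIV"
    and "(\<lambda>y. \<Sum>\<^sub>\<infinity>x. f x y) summable_on UNIV"
    and "(\<Sum>\<^sub>\<infinity>y. \<Sum>\<^sub>\<infinity>x. f x y) = (\<Sum>\<^sub>\<infinity>x. \<Sum>\<^sub>\<infinity>y. f x y)"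
proof -
  have "(\<lambda>p. f (fst p) (snd p)) summable_on Sigma UNIV (\<lambda>_. UNIV)"
    by (rule summable_on_SigmaI[OF _ outer]) (use nonneg inner in auto)
  then have s: "(\<lambda>(x, y). f x y) summable_on UNIV \<times> UNIV"
    by (simp add: case_prod_beta')
  then have t: "(\<lambda>(y, x). f x y) summable_on UNIV \<times> UNIV"
    using summable_on_swap[of "\<lambda>(x, y). f x y" UNIV UNIV] by (simp add: case_prod_beta')
  show "(\<lambda>x. f x y) summable_on UNIV"
    using summable_on_SigmaD1[OF t, of y] by simp
  show "(\<lambda>y. \<Sum>\<^sub>\<infinity>x. f x y) summable_on UNIV"
    using summable_on_Sigma_banach[OF t] by simp
  show "(\<Sum>\<^sub>\<infinity>y. \<Sum>\<^sub>\<infinity>x. f x y) = (\<Sum>\<^sub>\<infinity>x. \<Sum>\<^sub>\<infinity>y. f x y)"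
    using infsum_swap_banach[OF s] by simp
qed

lemma infsum_pos:
  fixes f :: "'a \<Rightarrow> real"
  assumes "f summable_on UNIV" and "\<And>x. f x > 0"
  shows "(\<Sum>\<^sub>\<infinity>x. f x) > 0"
proof -
  \<comment> \<open>Any single point will do; \<open>undefined\<close> merely names one.\<close>
  have "sum f {undefined} \<le> (\<Sum>\<^sub>\<infinity>x. f x)"
    by (rule finite_sum_le_infsum) (use assms less_imp_le in auto)
  then show ?thesis using assms(2)[of undefined] by simp
qed

lemma abs_infsum_mult_le:
  fixes f w :: "'a \<Rightarrow> real"
  assumes "(\<lambda>x. \<bar>f x\<bar> * w x) summable_on UNIV" and "\<And>x. w x \<ge> 0"
  shows "\<bar>\<Sum>\<^sub>\<infinity>x. f x * w x\<bar> \<le> (\<Sum>\<^sub>\<infinity>x. \<bar>f x\<bar> * w x)"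
  using norm_infsum_bound[of "\<lambda>x. f x * w x" UNIV] assms by (simp add: abs_mult)

text \<open>Passage from suprema in [0, infinity] to real inequalities. The sign of \<open>c\<close>
  matters because \<open>ennreal\<close> sends negative numbers to 0.\<close>

lemma sup_dev_le_iff:
  assumes "c \<ge> 0"
  shows "sup_dev S w T L \<le> ennreal c \<longleftrightarrow>
           (\<forall>x\<in>S. \<forall>f. (\<lambda>x. \<bar>f x\<bar> * w x) summable_on UNIV \<longrightarrow> (\<Sum>\<^sub>\<infinity>x. \<bar>f x\<bar> * w x) \<le> 1 \<longrightarrow>
              \<bar>T f x - L f\<bar> \<le> c)"
  using assms by (auto simp: sup_dev_def SUP_le_iff l1_unit_ball_def l1_norm_def ennreal_le_iff)

text \<open>The two operators differ only in whether \<open>1 / V\<close> is taken at the starting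
  or at the arrival point. A single kernel \<open>K\<close> lets one argument cover both.\<close>

definition kernel_op :: "('a \<Rightarrow> 'a \<Rightarrow> real) \<Rightarrow> ('a \<Rightarrow> real) \<Rightarrow> 'a \<Rightarrow> real" where
  "kernel_op K f x = (\<Sum>\<^sub>\<infinity>y. K x y * f y)"

lemma fk_op_eq_kernel_op:
  fixes f :: "'a \<Rightarrow> real"
  shows "fk_op P V f = kernel_op (\<lambda>x y. P x y / V x) f"
proof
  fix x
  show "fk_op P V f x = kernel_op (\<lambda>x y. P x y / V x) f x"
    unfolding fk_op_def kernel_op_def
    by (simp add: infsum_cmult_right'[symmetric])
qed

lemma fk_dual_op_eq_kernel_op:
  fixes f :: "'a \<Rightarrow> real"
  shows "fk_dual_op P' V f = kernel_op (\<lambda>x y. P' x y / V y) f"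
  by (simp add: fun_eq_iff fk_dual_op_def kernel_op_def)

section \<open>Normalization by a ground state\<close>

text \<open>The left eigenvector \<open>w\<close> will be the ground state of the adjoint times
  \<open>\<mu>\<close>. The eigenvalue equations use \<open>has_sum\<close> so that they include
  convergence.\<close>

locale kernel_ground_state =
  fixes K :: "'a \<Rightarrow> 'a \<Rightarrow> real" and \<phi> w :: "'a \<Rightarrow> real" and \<rho> b :: real
  assumes K_nonneg: "K x y \<ge> 0"
    and \<phi>_pos: "\<phi> x > 0"
    and w_pos: "w x > 0"
    and \<rho>_pos: "\<rho> > 0"
    and \<phi>_le: "\<phi> x \<le> b"
    and w_summable: "w summable_on UNIV"
    and right_eigen: "((\<lambda>y. K x y * \<phi> y) has_sum \<rho> * \<phi> x) UNIV"
    and left_eigen: "((\<lambda>x. w x * K x y) has_sum \<rho> * w y) UNIV"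
begin

definition mass :: real where
  "mass = (\<Sum>\<^sub>\<infinity>x. w x)"

definition pairing :: real where
  "pairing = (\<Sum>\<^sub>\<infinity>x. \<phi> x * w x)"

text \<open>This is \<open>D\<close> of the overview. The prefactor cancels when the value at
  \<open>h\<close> is divided by the value at 1.\<close>

definition scaled_iter :: "nat \<Rightarrow> ('a \<Rightarrow> real) \<Rightarrow> 'a \<Rightarrow> real" where
  "scaled_iter n h x = inverse (\<rho> ^ n) * inverse (\<phi> x) * (kernel_op K ^^ n) h x"

lemma b_pos: "b > 0"
  using \<phi>_pos \<phi>_le less_le_trans by blast

lemma \<phi>_w_summable: "(\<lambda>x. \<phi> x * w x) summable_on UNIV"
proof (rule summable_on_comparison_test)
  show "(\<lambda>x. b * w x) summable_on UNIV"
    by (rule summable_on_cmult_right[OF w_summable])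
qed (use \<phi>_pos \<phi>_le w_pos in \<open>auto intro!: mult_right_mono mult_nonneg_nonneg less_imp_le\<close>)

lemma mass_pos: "mass > 0"
  unfolding mass_def by (rule infsum_pos[OF w_summable w_pos])

lemma pairing_pos: "pairing > 0"
  unfolding pairing_def by (rule infsum_pos[OF \<phi>_w_summable]) (simp add: \<phi>_pos w_pos)

text \<open>By Tonelli, summing over \<open>x\<close> against \<open>w\<close> first reproduces
  \<open>\<rho> * w y\<close>. Hence the operator keeps nonnegative functions in ell1(w), and the
  sums met when iterating it on 1 are genuine rather than default values.\<close>

lemma kernel_op_l1:
  assumes h: "(\<lambda>x. h x * w x) summable_on UNIV" and nn: "\<And>x. h x \<ge> 0"
  shows "(\<lambda>y. K x y * h y) summable_on UNIV"
    and "(\<lambda>x. kernel_op K h x * w x) summable_on UNIV"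
proof -
  let ?f = "\<lambda>y x. h y * (w x * K x y)"
  have inner: "(?f y has_sum h y * (\<rho> * w y)) UNIV" for y
    by (rule has_sum_cmult_right[OF left_eigen])
  have outer: "(\<lambda>y. \<Sum>\<^sub>\<infinity>x. ?f y x) summable_on UNIV"
    using summable_on_cmult_right[OF h, of \<rho>]
    by (simp add: infsumI[OF inner] mult.left_commute)
  have nonneg: "?f y x \<ge> 0" for x y
    using nn K_nonneg w_pos by (simp add: less_imp_le)
  note ton = tonelli_infsum[of ?f, OF nonneg has_sum_imp_summable[OF inner] outer]
  have "(\<lambda>y. inverse (w x) * ?f y x) summable_on UNIV"
    by (rule summable_on_cmult_right[OF ton(1)])
  then show "(\<lambda>y. K x y * h y) summable_on UNIV"
    using w_pos[of x] by (simp add: field_simps)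
  have "(\<Sum>\<^sub>\<infinity>y. ?f y x) = kernel_op K h x * w x" for x
    unfolding kernel_op_def infsum_cmult_left'[symmetric] by (simp add: mult_ac)
  then show "(\<lambda>x. kernel_op K h x * w x) summable_on UNIV"
    using ton(2) by simp
qed

text \<open>Holds for every \<open>h\<close>: for \<open>c\<close> nonzero both sums converge or
  both take the default value 0, and for \<open>c = 0\<close> both sides vanish.\<close>

lemma kernel_op_scale: "kernel_op K (\<lambda>x. c * h x) = (\<lambda>x. c * kernel_op K h x)"
  by (simp add: fun_eq_iff kernel_op_def infsum_cmult_right'[symmetric] mult.left_commute)

lemma scaled_iter_scale: "scaled_iter n (\<lambda>x. c * h x) x = c * scaled_iter n h x"
proof -
  have "(kernel_op K ^^ n) (\<lambda>x. c * h x) = (\<lambda>x. c * (kernel_op K ^^ n) h x)"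
    by (induction n) (simp_all add: kernel_op_scale)
  then show ?thesis by (simp add: scaled_iter_def)
qed

lemma iter_\<phi>: "(kernel_op K ^^ n) \<phi> = (\<lambda>x. \<rho> ^ n * \<phi> x)"
proof (induction n)
  case (Suc n)
  have "kernel_op K \<phi> = (\<lambda>x. \<rho> * \<phi> x)"
    by (simp add: fun_eq_iff kernel_op_def infsumI[OF right_eigen])
  then show ?case by (simp add: Suc kernel_op_scale mult.assoc mult.left_commute)
qed simp

lemma scaled_iter_\<phi>: "scaled_iter n \<phi> x = 1"
  using \<phi>_pos[of x] \<rho>_pos by (simp add: scaled_iter_def iter_\<phi> field_simps)

text \<open>Positivity preserves \<open>\<phi> / b \<le> 1\<close> under iteration, while
  \<open>\<phi>\<close> only gains powers of \<open>\<rho>\<close>. Both claims share one induction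
  because comparing the sums in the step needs the summability from the second.\<close>

lemma iter_one_ge:
  "\<rho> ^ n * \<phi> x / b \<le> (kernel_op K ^^ n) (\<lambda>_. 1) x"
  "(\<lambda>x. (kernel_op K ^^ n) (\<lambda>_. 1) x * w x) summable_on UNIV"
proof (induction n arbitrary: x)
  case 0
  { case 1 show ?case using \<phi>_le b_pos by simp }
  { case 2 show ?case using w_summable by simp }
next
  case (Suc n)
  let ?g = "(kernel_op K ^^ n) (\<lambda>_. 1)"
  have lower: "0 \<le> \<rho> ^ n * \<phi> y / b" for y
    using \<rho>_pos \<phi>_pos b_pos by (simp add: less_imp_le)
  then have nn: "?g y \<ge> 0" for y
    using Suc(1) order_trans by blast
  note l1 = kernel_op_l1[OF Suc(2) nn]
  { case 1
    have s: "((\<lambda>y. (\<rho> ^ n / b) * (K x y * \<phi> y)) has_sum (\<rho> ^ n / b) * (\<rho> * \<phi> x)) UNIV"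
      by (rule has_sum_cmult_right[OF right_eigen])
    have "(\<rho> ^ n / b) * (\<rho> * \<phi> x) \<le> (\<Sum>\<^sub>\<infinity>y. K x y * ?g y)"
    proof (rule has_sum_mono[OF s has_sum_infsum[OF l1(1)]])
      fix y
      show "(\<rho> ^ n / b) * (K x y * \<phi> y) \<le> K x y * ?g y"
        using mult_left_mono[OF Suc(1)[of y] K_nonneg[of x y]] by (simp add: mult_ac)
    qed
    then show ?case by (simp add: kernel_op_def[of K ?g x] mult_ac) }
  { case 2 show ?case using l1(2) by simp }
qed

lemma scaled_iter_one_ge: "scaled_iter n (\<lambda>_. 1) x \<ge> 1 / b"
proof -
  have "inverse (\<rho> ^ n) * inverse (\<phi> x) * (\<rho> ^ n * \<phi> x / b) \<le> scaled_iter n (\<lambda>_. 1) x"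
    unfolding scaled_iter_def
    by (rule mult_left_mono[OF iter_one_ge(1)]) (use \<rho>_pos \<phi>_pos in \<open>simp add: less_imp_le\<close>)
  then show ?thesis using \<rho>_pos \<phi>_pos[of x] by (simp add: field_simps)
qed

lemma scaled_iter_one_pos: "scaled_iter n (\<lambda>_. 1) x > 0"
  using scaled_iter_one_ge[of n x] b_pos by (meson less_le_trans zero_less_divide_1_iff)

lemma normalized_op_eq:
  "normalized_op (kernel_op K) n h x = scaled_iter n h x / scaled_iter n (\<lambda>_. 1) x"
  using \<rho>_pos \<phi>_pos[of x] by (simp add: normalized_op_def scaled_iter_def)

lemma intrinsic_op_eq:
  "intrinsic_op (kernel_op K) \<rho> \<phi> n f x = scaled_iter n (\<lambda>y. f y * \<phi> y) x"
  by (simp add: intrinsic_op_def scaled_iter_def)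

section \<open>Deviation bounds in homogeneous form\<close>

text \<open>Statement (a) at one point, with the substitution \<open>h = f * \<phi>\<close> already
  made and the unit ball replaced by a bound \<open>t\<close> on the norm. An upper bound
  \<open>t > 0\<close> instead of the norm itself permits division by \<open>t\<close> and still
  covers \<open>h = 0\<close>.\<close>

definition intrinsic_dev :: "nat \<Rightarrow> 'a \<Rightarrow> real \<Rightarrow> bool" where
  "intrinsic_dev n x c \<longleftrightarrow>
     (\<forall>h t. (\<lambda>x. \<bar>h x\<bar> * w x) summable_on UNIV \<longrightarrow> (\<Sum>\<^sub>\<infinity>x. \<bar>h x\<bar> * w x) \<le> t \<longrightarrow> t > 0 \<longrightarrow>
        \<bar>scaled_iter n h x - (\<Sum>\<^sub>\<infinity>x. h x * w x) / pairing\<bar> \<le> c * t)"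

definition normalized_dev :: "nat \<Rightarrow> 'a \<Rightarrow> real \<Rightarrow> bool" where
  "normalized_dev n x c \<longleftrightarrow>
     (\<forall>h t. (\<lambda>x. \<bar>h x\<bar> * w x) summable_on UNIV \<longrightarrow> (\<Sum>\<^sub>\<infinity>x. \<bar>h x\<bar> * w x) \<le> t \<longrightarrow> t > 0 \<longrightarrow>
        \<bar>scaled_iter n h x / scaled_iter n (\<lambda>_. 1) x - (\<Sum>\<^sub>\<infinity>x. h x * w x) / mass\<bar> \<le> c * t / mass)"

text \<open>Rescaling by \<open>inverse t\<close> brings \<open>f\<close> into the unit
  ball.\<close>

lemma abs_le_by_homogeneity:
  fixes F :: "('a \<Rightarrow> real) \<Rightarrow> real"
  assumes ball: "\<And>g. (\<lambda>x. \<bar>g x\<bar> * u x) summable_on UNIV \<Longrightarrow> (\<Sum>\<^sub>\<infinity>x. \<bar>g x\<bar> * u x) \<le> 1 \<Longrightarrow> \<bar>F g\<bar> \<le> c"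
    and F_scale: "\<And>a g. F (\<lambda>x. a * g x) = a * F g"
    and f: "(\<lambda>x. \<bar>f x\<bar> * u x) summable_on UNIV" "(\<Sum>\<^sub>\<infinity>x. \<bar>f x\<bar> * u x) \<le> t" and t: "t > 0"
  shows "\<bar>F f\<bar> \<le> c * t"
proof -
  have eq: "\<bar>inverse t * f x\<bar> * u x = inverse t * (\<bar>f x\<bar> * u x)" for x
    using t by (simp add: abs_mult)
  have "\<bar>F (\<lambda>x. inverse t * f x)\<bar> \<le> c"
  proof (rule ball)
    show "(\<lambda>x. \<bar>inverse t * f x\<bar> * u x) summable_on UNIV"
      unfolding eq by (rule summable_on_cmult_right[OF f(1)])
    show "(\<Sum>\<^sub>\<infinity>x. \<bar>inverse t * f x\<bar> * u x) \<le> 1"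
      unfolding eq infsum_cmult_right' using f(2) t by (simp add: field_simps)
  qed
  then have "\<bar>inverse t\<bar> * \<bar>F f\<bar> \<le> c"
    unfolding F_scale abs_mult .
  then show ?thesis
    using t by (simp add: field_simps)
qed

text \<open>As \<open>\<phi>\<close> is positive, multiplication by it is an isometry from
  ell1(\<open>\<phi> * w\<close>) onto ell1(w). Homogeneity extends the bound beyond the unit
  ball.\<close>

lemma sup_dev_intrinsic_le_iff:
  assumes "c \<ge> 0"
  shows "sup_dev S (\<lambda>x. \<phi> x * w x) (intrinsic_op (kernel_op K) \<rho> \<phi> n) (wmean (\<lambda>x. \<phi> x * w x))
           \<le> ennreal c \<longleftrightarrow> (\<forall>x\<in>S. intrinsic_dev n x c)"
proof -
  have weight: "\<bar>f x * \<phi> x\<bar> * w x = \<bar>f x\<bar> * (\<phi> x * w x)" for f x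
    using \<phi>_pos[of x] by (simp add: abs_mult)
  have "(\<forall>f. (\<lambda>x. \<bar>f x\<bar> * (\<phi> x * w x)) summable_on UNIV \<longrightarrow>
            (\<Sum>\<^sub>\<infinity>x. \<bar>f x\<bar> * (\<phi> x * w x)) \<le> 1 \<longrightarrow>
            \<bar>scaled_iter n (\<lambda>y. f y * \<phi> y) x - (\<Sum>\<^sub>\<infinity>x. f x * (\<phi> x * w x)) / pairing\<bar> \<le> c)
         \<longleftrightarrow> intrinsic_dev n x c" (is "?L \<longleftrightarrow> ?R") for x
  proof
    assume L: ?L
    show ?R
      unfolding intrinsic_dev_def
    proof (intro allI impI)
      fix h :: "'a \<Rightarrow> real" and t :: real
      assume h: "(\<lambda>x. \<bar>h x\<bar> * w x) summable_on UNIV" "(\<Sum>\<^sub>\<infinity>x. \<bar>h x\<bar> * w x) \<le> t" "t > 0"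
      show "\<bar>scaled_iter n h x - (\<Sum>\<^sub>\<infinity>x. h x * w x) / pairing\<bar> \<le> c * t"
      proof (rule abs_le_by_homogeneity[where u = w, OF _ _ h])
        fix g :: "'a \<Rightarrow> real"
        assume g: "(\<lambda>x. \<bar>g x\<bar> * w x) summable_on UNIV" "(\<Sum>\<^sub>\<infinity>x. \<bar>g x\<bar> * w x) \<le> 1"
        have cancel: "g y / \<phi> y * \<phi> y = g y" "\<bar>g y / \<phi> y\<bar> * (\<phi> y * w y) = \<bar>g y\<bar> * w y"
          "g y / \<phi> y * (\<phi> y * w y) = g y * w y" for y
          using \<phi>_pos[of y] by simp_all
        show "\<bar>scaled_iter n g x - (\<Sum>\<^sub>\<infinity>x. g x * w x) / pairing\<bar> \<le> c"
          using L[rule_format, of "\<lambda>y. g y / \<phi> y"] g unfolding cancel by blast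
      next
        fix a :: real and g :: "'a \<Rightarrow> real"
        show "scaled_iter n (\<lambda>x. a * g x) x - (\<Sum>\<^sub>\<infinity>x. a * g x * w x) / pairing =
              a * (scaled_iter n g x - (\<Sum>\<^sub>\<infinity>x. g x * w x) / pairing)"
          by (simp add: scaled_iter_scale mult.assoc infsum_cmult_right' right_diff_distrib)
      qed
    qed
  next
    assume R: ?R
    show ?L
      using R[unfolded intrinsic_dev_def, rule_format, of "\<lambda>y. f y * \<phi> y" 1 for f]
      unfolding weight by (simp add: mult.assoc)
  qed
  then show ?thesis
    by (simp add: sup_dev_le_iff[OF assms] intrinsic_op_eq wmean_def wsum_def pairing_def)
qed

text \<open>The norms for \<open>w\<close> and \<open>w / mass\<close> differ by the factor
  \<open>mass\<close>, so the unit ball corresponds to \<open>t = mass\<close>; this is where the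
  \<open>mass\<close> in \<open>normalized_dev\<close> comes from.\<close>

lemma sup_dev_normalized_le_iff:
  assumes "c \<ge> 0"
  shows "sup_dev S (\<lambda>x. w x / mass) (normalized_op (kernel_op K) n) (wsum (\<lambda>x. w x / mass))
           \<le> ennreal c \<longleftrightarrow> (\<forall>x\<in>S. normalized_dev n x c)"
proof -
  let ?F = "\<lambda>x f. scaled_iter n f x / scaled_iter n (\<lambda>_. 1) x - (\<Sum>\<^sub>\<infinity>x. f x * w x) / mass"
  have scale: "u * (w x / mass) = inverse mass * (u * w x)" for u x
    by (simp add: divide_inverse mult_ac)
  have sum_eq: "(\<Sum>\<^sub>\<infinity>x. f x * (w x / mass)) = (\<Sum>\<^sub>\<infinity>x. f x * w x) / mass" for f :: "'a \<Rightarrow> real"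
    unfolding scale infsum_cmult_right' by (simp add: divide_inverse)
  have summable_eq: "(\<lambda>x. f x * (w x / mass)) summable_on UNIV \<longleftrightarrow> (\<lambda>x. f x * w x) summable_on UNIV"
    for f :: "'a \<Rightarrow> real"
    unfolding scale using mass_pos by (simp add: summable_on_cmult_right')
  have "(\<forall>f. (\<lambda>x. \<bar>f x\<bar> * (w x / mass)) summable_on UNIV \<longrightarrow>
            (\<Sum>\<^sub>\<infinity>x. \<bar>f x\<bar> * (w x / mass)) \<le> 1 \<longrightarrow> \<bar>?F x f\<bar> \<le> c)
         \<longleftrightarrow> normalized_dev n x c" (is "?L \<longleftrightarrow> ?R") for x
  proof
    assume L: ?L
    show ?R
      unfolding normalized_dev_def
    proof (intro allI impI)
      fix h :: "'a \<Rightarrow> real" and t :: real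
      assume h: "(\<lambda>x. \<bar>h x\<bar> * w x) summable_on UNIV" "(\<Sum>\<^sub>\<infinity>x. \<bar>h x\<bar> * w x) \<le> t" "t > 0"
      have "\<bar>?F x h\<bar> \<le> c * (t / mass)"
      proof (rule abs_le_by_homogeneity[where F = "?F x" and f = h and u = "\<lambda>x. w x / mass"])
        show "\<bar>?F x g\<bar> \<le> c" if "(\<lambda>x. \<bar>g x\<bar> * (w x / mass)) summable_on UNIV"
          "(\<Sum>\<^sub>\<infinity>x. \<bar>g x\<bar> * (w x / mass)) \<le> 1" for g
          using L that by blast
        show "?F x (\<lambda>x. a * g x) = a * ?F x g" for a g
          by (simp add: scaled_iter_scale mult.assoc infsum_cmult_right' right_diff_distrib)
      qed (unfold summable_eq sum_eq, use h mass_pos in \<open>auto intro: divide_right_mono\<close>)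
      then show "\<bar>?F x h\<bar> \<le> c * t / mass" by simp
    qed
  next
    assume R: ?R
    show ?L
      using R[unfolded normalized_dev_def, rule_format, of f mass for f] mass_pos
      unfolding summable_eq sum_eq by (simp add: field_simps)
  qed
  then show ?thesis
    unfolding sup_dev_le_iff[OF assms] normalized_op_eq wsum_def sum_eq by simp
qed

section \<open>Comparison of the two deviations\<close>

text \<open>The error of a quotient splits into the errors of numerator and denominator, each
  contributing at most \<open>c * t\<close>, hence the 2. Dividing by \<open>D 1\<close> costs
  \<open>b\<close>, and \<open>mass\<close> undoes the normalization of the weight.\<close>

lemma normalized_dev_if_intrinsic_dev:
  assumes c: "c \<ge> 0" and dev: "intrinsic_dev n x c"
  shows "normalized_dev n x (2 * b * mass * c)"
  unfolding normalized_dev_def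
proof (intro allI impI)
  fix h :: "'a \<Rightarrow> real" and t :: real
  assume h: "(\<lambda>x. \<bar>h x\<bar> * w x) summable_on UNIV" "(\<Sum>\<^sub>\<infinity>x. \<bar>h x\<bar> * w x) \<le> t" "t > 0"
  define s where "s = (\<Sum>\<^sub>\<infinity>x. h x * w x)"
  define d where "d = scaled_iter n h x"
  define a where "a = scaled_iter n (\<lambda>_. 1) x"
  have a: "a > 0" "1 / a \<le> b"
    using scaled_iter_one_pos[of n x] scaled_iter_one_ge[of n x] b_pos
    by (auto simp: a_def field_simps)
  have s: "\<bar>s\<bar> \<le> t"
    unfolding s_def using abs_infsum_mult_le[OF h(1)] h(2) w_pos by (meson less_imp_le order_trans)
  have 1: "\<bar>d - s / pairing\<bar> \<le> c * t"
    using dev h unfolding intrinsic_dev_def d_def s_def by blast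
  \<comment> \<open>Test function 1, whose norm in ell1(w) is \<open>mass\<close>.\<close>
  have 2: "\<bar>a - mass / pairing\<bar> \<le> c * mass"
    using dev[unfolded intrinsic_dev_def, rule_format, of "\<lambda>_. 1" mass] w_summable mass_pos
    by (simp add: a_def mass_def)
  have "d / a - s / mass = (1 / a) * ((d - s / pairing) - s / mass * (a - mass / pairing))"
    using a(1) mass_pos by (simp add: field_simps)
  also have "\<bar>\<dots>\<bar> = (1 / a) * \<bar>(d - s / pairing) - s / mass * (a - mass / pairing)\<bar>"
    using a(1) by (simp add: abs_mult)
  also have "\<dots> \<le> b * (c * t + t / mass * (c * mass))"
  proof (rule mult_mono[OF a(2)])
    have "\<bar>s / mass * (a - mass / pairing)\<bar> \<le> t / mass * (c * mass)"
      unfolding abs_mult using s 2 mass_pos h(3) c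
      by (intro mult_mono) (simp_all add: divide_right_mono)
    with 1 show "\<bar>(d - s / pairing) - s / mass * (a - mass / pairing)\<bar> \<le> c * t + t / mass * (c * mass)"
      by linarith
  qed (use b_pos in auto)
  also have "\<dots> = 2 * b * mass * c * t / mass"
    using mass_pos by (simp add: field_simps)
  finally show "\<bar>scaled_iter n h x / scaled_iter n (\<lambda>_. 1) x - (\<Sum>\<^sub>\<infinity>x. h x * w x) / mass\<bar>
      \<le> 2 * b * mass * c * t / mass"
    unfolding d_def a_def s_def .
qed

text \<open>Testing with \<open>\<phi>\<close> gives a lower bound for \<open>1 / D 1\<close>, so
  \<open>q < 1\<close> bounds \<open>D 1\<close> from above independently of \<open>n\<close> and
  \<open>x\<close>. The 2 again counts two errors.\<close>

lemma intrinsic_dev_if_normalized_dev: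
  assumes c: "c \<ge> 0" "c \<le> q" "q < 1" and dev: "normalized_dev n x c"
  shows "intrinsic_dev n x (2 / (pairing * (1 - q)) * c)"
  unfolding intrinsic_dev_def
proof (intro allI impI)
  fix h :: "'a \<Rightarrow> real" and t :: real
  assume h: "(\<lambda>x. \<bar>h x\<bar> * w x) summable_on UNIV" "(\<Sum>\<^sub>\<infinity>x. \<bar>h x\<bar> * w x) \<le> t" "t > 0"
  define s where "s = (\<Sum>\<^sub>\<infinity>x. h x * w x)"
  define d where "d = scaled_iter n h x"
  define a where "a = scaled_iter n (\<lambda>_. 1) x"
  have a: "a > 0" using scaled_iter_one_pos by (simp add: a_def)
  have s: "\<bar>s\<bar> \<le> t"
    unfolding s_def using abs_infsum_mult_le[OF h(1)] h(2) w_pos by (meson less_imp_le order_trans)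
  have 1: "\<bar>d / a - s / mass\<bar> \<le> c * t / mass"
    using dev h unfolding normalized_dev_def d_def s_def a_def by blast
  have \<phi>_abs: "\<bar>\<phi> y\<bar> = \<phi> y" for y
    using \<phi>_pos[of y] by simp
  \<comment> \<open>Test function \<open>\<phi>\<close>, with norm \<open>pairing\<close> and
    \<open>D \<phi> = 1\<close>; this isolates \<open>1 / a\<close>.\<close>
  have 2: "\<bar>1 / a - pairing / mass\<bar> \<le> c * pairing / mass"
    using dev[unfolded normalized_dev_def, rule_format, of \<phi> pairing] \<phi>_w_summable pairing_pos
    by (simp add: a_def pairing_def scaled_iter_\<phi> \<phi>_abs)
  have "(1 - q) * (pairing / mass) \<le> (1 - c) * (pairing / mass)"
    by (rule mult_right_mono) (use c pairing_pos mass_pos in auto)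
  also have "\<dots> \<le> 1 / a"
    using 2 unfolding left_diff_distrib diff_divide_distrib mult_1 times_divide_eq_right abs_le_iff by linarith
  finally have a_le: "a \<le> mass / (pairing * (1 - q))"
    using a pairing_pos mass_pos c(3) by (simp add: field_simps)
  have "\<bar>s * ((a / pairing) * (1 / a - pairing / mass))\<bar> \<le> t * ((a / pairing) * (c * pairing / mass))"
    unfolding abs_mult using s 2 h(3) a pairing_pos mass_pos c(1)
    by (intro mult_mono) auto
  moreover have "\<bar>a * (d / a - s / mass)\<bar> \<le> a * (c * t / mass)"
    unfolding abs_mult using 1 a by (intro mult_mono) auto
  \<comment> \<open>The quantity \<open>a * s / mass\<close> is subtracted and added back.\<close>
  moreover have "d - s / pairing =
      a * (d / a - s / mass) - s * ((a / pairing) * (1 / a - pairing / mass))"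
    using a pairing_pos mass_pos by (simp add: field_simps)
  ultimately have "\<bar>d - s / pairing\<bar> \<le>
      a * (c * t / mass) + t * ((a / pairing) * (c * pairing / mass))"
    by linarith
  also have "\<dots> = a * (2 * c * t / mass)"
    using pairing_pos by (simp add: field_simps)
  also have "\<dots> \<le> mass / (pairing * (1 - q)) * (2 * c * t / mass)"
    by (rule mult_right_mono[OF a_le]) (use c h(3) mass_pos in simp)
  also have "\<dots> = 2 / (pairing * (1 - q)) * c * t"
    using mass_pos by simp
  finally show "\<bar>scaled_iter n h x - (\<Sum>\<^sub>\<infinity>x. h x * w x) / pairing\<bar>
      \<le> 2 / (pairing * (1 - q)) * c * t"
    unfolding d_def s_def .
qed

section \<open>Rates along a sequence of sets\<close>

context
  fixes \<kappa> :: "nat \<Rightarrow> real" and A :: "nat \<Rightarrow> 'a set" and N :: nat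
  assumes \<kappa>_nonneg: "\<And>n. n \<ge> N \<Longrightarrow> \<kappa> n \<ge> 0"
begin

lemma normalized_rate_if_intrinsic_rate:
  assumes "\<exists>C1>0. \<forall>n\<ge>N. sup_dev (A n) (\<lambda>x. \<phi> x * w x) (intrinsic_op (kernel_op K) \<rho> \<phi> n)
             (wmean (\<lambda>x. \<phi> x * w x)) \<le> ennreal (C1 * \<kappa> n)"
  shows "\<exists>C2>0. \<forall>n\<ge>N. sup_dev (A n) (\<lambda>x. w x / mass) (normalized_op (kernel_op K) n)
             (wsum (\<lambda>x. w x / mass)) \<le> ennreal (C2 * \<kappa> n)"
proof -
  obtain C1 where C1: "C1 > 0" and dev: "\<And>n. n \<ge> N \<Longrightarrow> \<forall>x\<in>A n. intrinsic_dev n x (C1 * \<kappa> n)"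
    using assms \<kappa>_nonneg by (auto simp: sup_dev_intrinsic_le_iff)
  let ?C2 = "2 * b * mass * C1"
  have C2: "?C2 > 0" using C1 b_pos mass_pos by simp
  have "\<forall>x\<in>A n. normalized_dev n x (?C2 * \<kappa> n)" if "n \<ge> N" for n
    using normalized_dev_if_intrinsic_dev[of "C1 * \<kappa> n"] dev[OF that] C1 \<kappa>_nonneg[OF that]
    by (simp add: mult.assoc)
  then show ?thesis
    using C2 \<kappa>_nonneg by (intro exI[of _ ?C2]) (simp add: sup_dev_normalized_le_iff)
qed

lemma intrinsic_rate_if_normalized_rate:
  assumes C2: "C2 > 0"
    and rate: "\<forall>n\<ge>N. sup_dev (A n) (\<lambda>x. w x / mass) (normalized_op (kernel_op K) n)
             (wsum (\<lambda>x. w x / mass)) \<le> ennreal (C2 * \<kappa> n)"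
    and lt1: "(SUP n\<in>{N..}. ennreal (C2 * \<kappa> n)) < 1"
  shows "\<exists>C1>0. \<forall>n\<ge>N. sup_dev (A n) (\<lambda>x. \<phi> x * w x) (intrinsic_op (kernel_op K) \<rho> \<phi> n)
             (wmean (\<lambda>x. \<phi> x * w x)) \<le> ennreal (C1 * \<kappa> n)"
proof -
  \<comment> \<open>Being below 1, the supremum is finite and hence a real \<open>q\<close>, which
    serves as the uniform bound for the comparison.\<close>
  obtain q where q: "q \<ge> 0" "(SUP n\<in>{N..}. ennreal (C2 * \<kappa> n)) = ennreal q"
    using lt1 by (metis ennreal_cases ennreal_less_top less_trans ennreal_1 less_irrefl)
  have q1: "q < 1" using q lt1 by (metis ennreal_1 ennreal_less_iff)
  have le_q: "C2 * \<kappa> n \<le> q" if "n \<ge> N" for n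
  proof -
    have "ennreal (C2 * \<kappa> n) \<le> ennreal q"
      unfolding q(2)[symmetric] by (rule SUP_upper) (use that in simp)
    then show ?thesis using q(1) by simp
  qed
  define C1 where "C1 = 2 / (pairing * (1 - q)) * C2"
  have C1: "C1 > 0" unfolding C1_def using C2 pairing_pos q1 by simp
  have "\<forall>x\<in>A n. intrinsic_dev n x (C1 * \<kappa> n)" if "n \<ge> N" for n
  proof
    fix x assume "x \<in> A n"
    then have "normalized_dev n x (C2 * \<kappa> n)"
      using rate[rule_format, OF that] C2 \<kappa>_nonneg[OF that] by (simp add: sup_dev_normalized_le_iff)
    from intrinsic_dev_if_normalized_dev[OF _ le_q[OF that] q1 this] C2 \<kappa>_nonneg[OF that]
    show "intrinsic_dev n x (C1 * \<kappa> n)" by (simp add: C1_def mult.assoc)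
  qed
  then show ?thesis
    using C1 \<kappa>_nonneg by (intro exI[of _ C1]) (simp add: sup_dev_intrinsic_le_iff)
qed

end

end

section \<open>Integrability of the ground states\<close>

text \<open>Off \<open>B\<close> this gives \<open>\<rho> * V x \<ge> 2\<close>; the 2 becomes the
  contraction factor 1/2 in the inequality for the ground states.\<close>

lemma confining_obtain:
  assumes "confining V" and "\<rho> > 0"
  obtains M B where "\<rho> * real M \<ge> 2" and "finite B" and "\<And>x. x \<notin> B \<Longrightarrow> V x \<ge> real M"
proof -
  obtain M where M: "real M > 2 / \<rho>"
    using reals_Archimedean2 by blast
  \<comment> \<open>\<open>confining\<close> only speaks about levels from 1 on; 0 is excluded since
    \<open>2 / \<rho>\<close> is positive.\<close>
  then have "M \<ge> 1" using assms(2) by (cases M) (auto simp: divide_less_0_iff)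
  then obtain B where "finite B" "\<forall>x. x \<notin> B \<longrightarrow> V x \<ge> real M"
    using assms(1) unfolding confining_def by blast
  with M assms(2) show ?thesis
    by (intro that[of M B]) (simp_all add: field_simps)
qed

section \<open>Mapping properties of the kernels on weighted spaces\<close>

locale dual_subprob_kernels =
  fixes P P' :: "'a \<Rightarrow> 'a \<Rightarrow> real" and \<mu> :: "'a \<Rightarrow> real" and k :: real
  assumes P_kernel: "subprob_kernel P"
    and P'_kernel: "subprob_kernel P'"
    and \<mu>_pos: "\<mu> x > 0"
    and duality: "\<mu> x * P x y = \<mu> y * P' y x"
    and P_le: "P x y \<le> k * \<mu> y"
begin

lemma P_nonneg: "P x y \<ge> 0" and P_summable: "P x summable_on UNIV" and P_sum: "(\<Sum>\<^sub>\<infinity>y. P x y) \<le> 1"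
  using P_kernel by (auto simp: subprob_kernel_def)

lemma P'_nonneg: "P' x y \<ge> 0" and P'_summable: "P' x summable_on UNIV" and P'_sum: "(\<Sum>\<^sub>\<infinity>y. P' x y) \<le> 1"
  using P'_kernel by (auto simp: subprob_kernel_def)

text \<open>The bound \<open>k * \<mu> x * \<mu> y\<close> on \<open>\<mu> x * P x y\<close> is
  symmetric, so duality carries it over to \<open>P'\<close>. Every result for \<open>P\<close> is
  thereby available for \<open>P'\<close>.\<close>

lemma dual: "dual_subprob_kernels P' P \<mu> k"
proof
  show "P' x y \<le> k * \<mu> y" for x y
  proof -
    have "\<mu> x * P' x y \<le> \<mu> x * (k * \<mu> y)"
      using mult_left_mono[OF P_le[of y x], of "\<mu> y"] \<mu>_pos[of y] duality[of y x]
      by (simp add: mult_ac)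
    then show ?thesis using \<mu>_pos[of x] by simp
  qed
qed (use P_kernel P'_kernel \<mu>_pos duality in auto)

text \<open>Duality turns the column sums of \<open>P\<close> weighted by \<open>\<mu>\<close> into
  row sums of \<open>P'\<close>, which are at most 1.\<close>

lemma l1_contraction:
  assumes u: "(\<lambda>x. u x * \<mu> x) summable_on UNIV" and nn: "\<And>x. u x \<ge> 0"
  shows "(\<lambda>y. P x y * u y) summable_on UNIV"
    and "(\<lambda>x. (\<Sum>\<^sub>\<infinity>y. P x y * u y) * \<mu> x) summable_on UNIV"
    and "(\<Sum>\<^sub>\<infinity>x. (\<Sum>\<^sub>\<infinity>y. P x y * u y) * \<mu> x) \<le> (\<Sum>\<^sub>\<infinity>x. u x * \<mu> x)"
proof -
  let ?f = "\<lambda>y x. u y * \<mu> y * P' y x"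
  have inner: "?f y summable_on UNIV" for y
    by (rule summable_on_cmult_right[OF P'_summable])
  have inner_le: "(\<Sum>\<^sub>\<infinity>x. ?f y x) \<le> u y * \<mu> y" for y
    using mult_left_mono[OF P'_sum[of y], of "u y * \<mu> y"] nn[of y] \<mu>_pos[of y]
    by (simp add: infsum_cmult_right')
  have nonneg: "?f y x \<ge> 0" for x y
    using nn P'_nonneg \<mu>_pos by (simp add: less_imp_le)
  have outer: "(\<lambda>y. \<Sum>\<^sub>\<infinity>x. ?f y x) summable_on UNIV"
    by (rule summable_on_comparison_test[OF u]) (use inner_le nonneg in \<open>auto intro: infsum_nonneg\<close>)
  note ton = tonelli_infsum[of ?f, OF nonneg inner outer]
  have eq: "?f y x = P x y * u y * \<mu> x" for x y
    using duality[of x y] by (simp add: mult_ac)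
  have sum_eq: "(\<Sum>\<^sub>\<infinity>y. ?f y x) = (\<Sum>\<^sub>\<infinity>y. P x y * u y) * \<mu> x" for x
    unfolding eq by (rule infsum_cmult_left')
  have "(\<lambda>y. P x y * u y * \<mu> x * inverse (\<mu> x)) summable_on UNIV"
    using ton(1)[of x] unfolding eq by (rule summable_on_cmult_left)
  then show "(\<lambda>y. P x y * u y) summable_on UNIV"
    using \<mu>_pos[of x] by (simp add: mult.assoc)
  show "(\<lambda>x. (\<Sum>\<^sub>\<infinity>y. P x y * u y) * \<mu> x) summable_on UNIV"
    using ton(2) unfolding sum_eq .
  have "(\<Sum>\<^sub>\<infinity>x. (\<Sum>\<^sub>\<infinity>y. P x y * u y) * \<mu> x) = (\<Sum>\<^sub>\<infinity>y. \<Sum>\<^sub>\<infinity>x. ?f y x)"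
    using ton(3) unfolding sum_eq .
  also have "\<dots> \<le> (\<Sum>\<^sub>\<infinity>x. u x * \<mu> x)"
    by (rule infsum_mono[OF outer u inner_le])
  finally show "(\<Sum>\<^sub>\<infinity>x. (\<Sum>\<^sub>\<infinity>y. P x y * u y) * \<mu> x) \<le> (\<Sum>\<^sub>\<infinity>x. u x * \<mu> x)" .
qed

text \<open>In \<open>\<psi> \<le> 1 + \<psi>\<^sup>2\<close> the constant is controlled by the row
  sum of \<open>P\<close> and the square by \<open>P_le\<close>.\<close>

lemma l2_imp_bounded:
  assumes \<psi>: "(\<lambda>x. (\<psi> x)\<^sup>2 * \<mu> x) summable_on UNIV" and nn: "\<And>x. \<psi> x \<ge> 0"
  shows "(\<lambda>y. P x y * \<psi> y) summable_on UNIV"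
    and "(\<Sum>\<^sub>\<infinity>y. P x y * \<psi> y) \<le> 1 + k * (\<Sum>\<^sub>\<infinity>x. (\<psi> x)\<^sup>2 * \<mu> x)"
proof -
  let ?d = "\<lambda>y. P x y + k * ((\<psi> y)\<^sup>2 * \<mu> y)"
  have ks: "(\<lambda>y. k * ((\<psi> y)\<^sup>2 * \<mu> y)) summable_on UNIV"
    by (rule summable_on_cmult_right[OF \<psi>])
  have d: "?d summable_on UNIV"
    by (rule summable_on_add[OF P_summable ks])
  have le: "P x y * \<psi> y \<le> ?d y" for y
  proof -
    have "\<psi> y \<le> 1 + (\<psi> y)\<^sup>2"
      using sum_squares_bound[of "\<psi> y" 1] nn[of y] by (simp; linarith)
    then have "P x y * \<psi> y \<le> P x y * (1 + (\<psi> y)\<^sup>2)"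
      by (rule mult_left_mono[OF _ P_nonneg])
    moreover have "P x y * (\<psi> y)\<^sup>2 \<le> k * \<mu> y * (\<psi> y)\<^sup>2"
      by (rule mult_right_mono[OF P_le]) simp
    ultimately show ?thesis by (simp add: algebra_simps)
  qed
  show s: "(\<lambda>y. P x y * \<psi> y) summable_on UNIV"
    by (rule summable_on_comparison_test[OF d le]) (simp add: P_nonneg nn)
  have "(\<Sum>\<^sub>\<infinity>y. P x y * \<psi> y) \<le> (\<Sum>\<^sub>\<infinity>y. ?d y)"
    by (rule infsum_mono[OF s d le])
  also have "\<dots> = (\<Sum>\<^sub>\<infinity>y. P x y) + k * (\<Sum>\<^sub>\<infinity>x. (\<psi> x)\<^sup>2 * \<mu> x)"
    by (simp add: infsum_add[OF P_summable ks] infsum_cmult_right')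
  finally show "(\<Sum>\<^sub>\<infinity>y. P x y * \<psi> y) \<le> 1 + k * (\<Sum>\<^sub>\<infinity>x. (\<psi> x)\<^sup>2 * \<mu> x)"
    using P_sum[of x] by linarith
qed

text \<open>
  The truncation \<open>(\<psi> - \<epsilon>)\<^sup>+ \<le> \<psi>\<^sup>2 / \<epsilon>\<close> is already known to be in
  \<open>\<ell>\<^sup>1(\<mu>)\<close> and inherits the inequality by Jensen, so the contraction on
  \<open>\<ell>\<^sup>1(\<mu>)\<close> bounds its norm uniformly in \<open>\<epsilon>\<close>.
\<close>

lemma l2_imp_l1:
  assumes \<psi>: "(\<lambda>x. (\<psi> x)\<^sup>2 * \<mu> x) summable_on UNIV" and nn: "\<And>x. \<psi> x \<ge> 0"
    and g: "(\<lambda>x. g x * \<mu> x) summable_on UNIV" and g_nn: "\<And>x. g x \<ge> 0"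
    and le: "\<And>x. \<psi> x \<le> g x + (\<Sum>\<^sub>\<infinity>y. P x y * \<psi> y) / 2"
  shows "(\<lambda>x. \<psi> x * \<mu> x) summable_on UNIV"
proof -
  define G where "G = (\<Sum>\<^sub>\<infinity>x. g x * \<mu> x)"
  have trunc: "(\<Sum>x\<in>F. (\<psi> x - \<epsilon>) * \<mu> x) \<le> 2 * G" if \<epsilon>: "\<epsilon> > 0" and F: "finite F" for \<epsilon> F
  proof -
    define u where "u x = max (\<psi> x - \<epsilon>) 0" for x
    have u_nn: "u x \<ge> 0" and u_ge: "\<psi> x - \<epsilon> \<le> u x" for x
      by (simp_all add: u_def)
    have u_le: "u x \<le> inverse \<epsilon> * (\<psi> x)\<^sup>2" for x
    proof (cases "\<psi> x \<le> \<epsilon>")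
      case False
      then have "\<epsilon> * u x \<le> \<psi> x * \<psi> x"
        unfolding u_def using \<epsilon> nn[of x] by (intro mult_mono) auto
      then show ?thesis using \<epsilon> by (simp add: field_simps power2_eq_square)
    qed (use \<epsilon> in \<open>simp add: u_def\<close>)
    have u: "(\<lambda>x. u x * \<mu> x) summable_on UNIV"
    proof (rule summable_on_comparison_test)
      show "(\<lambda>x. inverse \<epsilon> * ((\<psi> x)\<^sup>2 * \<mu> x)) summable_on UNIV"
        by (rule summable_on_cmult_right[OF \<psi>])
      show "u x * \<mu> x \<le> inverse \<epsilon> * ((\<psi> x)\<^sup>2 * \<mu> x)" for x
        using mult_right_mono[OF u_le[of x] less_imp_le[OF \<mu>_pos[of x]]] by (simp add: mult.assoc)
    qed (use u_nn \<mu>_pos in \<open>simp add: less_imp_le\<close>)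
    note Pu = l1_contraction[OF u u_nn]
    let ?Pu = "\<lambda>x. \<Sum>\<^sub>\<infinity>y. P x y * u y"
    have Pu_nn: "?Pu x \<ge> 0" for x
      by (rule infsum_nonneg) (simp add: P_nonneg u_nn)
    have u_sub: "u x \<le> g x + ?Pu x / 2" for x
    proof -
      have eps: "(\<lambda>y. P x y * \<epsilon>) summable_on UNIV"
        by (rule summable_on_cmult_left[OF P_summable])
      have "(\<Sum>\<^sub>\<infinity>y. P x y * \<psi> y) \<le> (\<Sum>\<^sub>\<infinity>y. P x y * u y + P x y * \<epsilon>)"
      proof (rule infsum_mono[OF l2_imp_bounded(1)[OF \<psi> nn] summable_on_add[OF Pu(1) eps]])
        show "P x y * \<psi> y \<le> P x y * u y + P x y * \<epsilon>" for y
          using mult_left_mono[of "\<psi> y" "u y + \<epsilon>" "P x y"] u_ge[of y] P_nonneg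
          by (simp add: distrib_left)
      qed
      also have "\<dots> = ?Pu x + (\<Sum>\<^sub>\<infinity>y. P x y) * \<epsilon>"
        by (simp add: infsum_add[OF Pu(1) eps] infsum_cmult_left')
      also have "\<dots> \<le> ?Pu x + \<epsilon>"
        using mult_right_mono[OF P_sum[of x], of \<epsilon>] \<epsilon> by simp
      \<comment> \<open>Averaging costs at most \<open>\<epsilon> / 2\<close>, less than the
        \<open>\<epsilon>\<close> subtracted on the left.\<close>
      finally have "\<psi> x - \<epsilon> \<le> g x + ?Pu x / 2"
        using le[of x] \<epsilon> by linarith
      then show ?thesis using g_nn[of x] Pu_nn[of x] by (simp add: u_def)
    qed
    have half: "(\<lambda>x. ?Pu x * \<mu> x / 2) summable_on UNIV"
      using summable_on_cmult_left[OF Pu(2), of "1/2"] by simp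
    have "(\<Sum>\<^sub>\<infinity>x. u x * \<mu> x) \<le> (\<Sum>\<^sub>\<infinity>x. g x * \<mu> x + ?Pu x * \<mu> x / 2)"
    proof (rule infsum_mono[OF u summable_on_add[OF g half]])
      show "u x * \<mu> x \<le> g x * \<mu> x + ?Pu x * \<mu> x / 2" for x
        using mult_right_mono[OF u_sub[of x] less_imp_le[OF \<mu>_pos[of x]]] by (simp add: distrib_right)
    qed
    also have "\<dots> = G + (\<Sum>\<^sub>\<infinity>x. ?Pu x * \<mu> x) / 2"
      using infsum_cmult_left'[of "\<lambda>x. ?Pu x * \<mu> x" "1/2" UNIV]
      by (simp add: infsum_add[OF g half] G_def)
    \<comment> \<open>By the contraction the last sum is at most the sum on the left; as the latter
      is finite, half of it can be absorbed.\<close>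
    finally have total: "(\<Sum>\<^sub>\<infinity>x. u x * \<mu> x) \<le> 2 * G"
      using Pu(3) by linarith
    have "(\<Sum>x\<in>F. (\<psi> x - \<epsilon>) * \<mu> x) \<le> (\<Sum>x\<in>F. u x * \<mu> x)"
      by (rule sum_mono) (simp add: mult_right_mono u_ge less_imp_le \<mu>_pos)
    also have "\<dots> \<le> (\<Sum>\<^sub>\<infinity>x. u x * \<mu> x)"
      by (rule finite_sum_le_infsum[OF u F]) (use u_nn \<mu>_pos in \<open>simp_all add: less_imp_le\<close>)
    finally show ?thesis using total by linarith
  qed
  \<comment> \<open>On a fixed finite set the truncation disappears as \<open>\<epsilon>\<close>
    tends to 0, and \<open>2 * G\<close> depends neither on \<open>\<epsilon>\<close> nor on
    \<open>F\<close>.\<close>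
  have "(\<Sum>x\<in>F. \<psi> x * \<mu> x) \<le> 2 * G" if F: "finite F" for F
  proof -
    have "((\<lambda>\<epsilon>. \<Sum>x\<in>F. (\<psi> x - \<epsilon>) * \<mu> x) \<longlongrightarrow> (\<Sum>x\<in>F. (\<psi> x - 0) * \<mu> x)) (at_right 0)"
      by (intro tendsto_intros)
    then have "(\<Sum>x\<in>F. (\<psi> x - 0) * \<mu> x) \<le> 2 * G"
      by (rule tendsto_upperbound)
        (auto intro: trunc[OF _ F] eventually_mono[OF eventually_at_right_less])
    then show ?thesis by simp
  qed
  then show ?thesis
    by (intro nonneg_bdd_above_summable_on)
      (auto intro!: bdd_aboveI2 simp: nn \<mu>_pos less_imp_le)
qed

section \<open>Boundedness and integrability of both ground states\<close>

text \<open>Boundedness follows by dividing the bound on \<open>P \<psi>\<close> by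
  \<open>\<rho> * V x \<ge> \<rho> * v\<close>. Off \<open>B\<close> the equation gives
  \<open>\<psi> \<le> P \<psi> / 2\<close>, so the remainder \<open>g\<close> is
  \<open>\<psi>\<close> restricted to a finite set.\<close>

lemma eigenfunction_bounded_l1:
  assumes V_ge: "\<And>x. V x \<ge> v" and v: "v > 0" and confining: "confining V" and \<rho>: "\<rho> > 0"
    and \<psi>: "(\<lambda>x. (\<psi> x)\<^sup>2 * \<mu> x) summable_on UNIV" and nn: "\<And>x. \<psi> x \<ge> 0"
    and eigen: "\<And>x. (\<Sum>\<^sub>\<infinity>y. P x y * \<psi> y) = \<rho> * V x * \<psi> x"
  shows "\<exists>b. \<forall>x. \<psi> x \<le> b" and "(\<lambda>x. \<psi> x * \<mu> x) summable_on UNIV"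
proof -
  let ?c = "1 + k * (\<Sum>\<^sub>\<infinity>x. (\<psi> x)\<^sup>2 * \<mu> x)"
  have "\<psi> x \<le> ?c / (\<rho> * v)" for x
  proof -
    have "\<psi> x * (\<rho> * v) \<le> \<psi> x * (\<rho> * V x)"
      using V_ge \<rho> nn by (intro mult_left_mono) auto
    also have "\<dots> \<le> ?c"
      using l2_imp_bounded(2)[OF \<psi> nn, of x] eigen[of x] by (simp add: mult_ac)
    finally show ?thesis using \<rho> v by (simp add: pos_le_divide_eq)
  qed
  then show "\<exists>b. \<forall>x. \<psi> x \<le> b" by blast
  obtain M B where M: "\<rho> * real M \<ge> 2" and B: "finite B" "\<And>x. x \<notin> B \<Longrightarrow> V x \<ge> real M"
    using confining_obtain[OF confining \<rho>] by blast
  define g where "g x = (if x \<in> B then \<psi> x else 0)" for x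
  show "(\<lambda>x. \<psi> x * \<mu> x) summable_on UNIV"
  proof (rule l2_imp_l1[OF \<psi> nn])
    show "(\<lambda>x. g x * \<mu> x) summable_on UNIV"
      by (rule finite_nonzero_values_imp_summable_on, rule finite_subset[OF _ B(1)])
        (auto simp: g_def split: if_splits)
    show "g x \<ge> 0" for x by (simp add: g_def nn)
    show "\<psi> x \<le> g x + (\<Sum>\<^sub>\<infinity>y. P x y * \<psi> y) / 2" for x
    proof (cases "x \<in> B")
      case True
      then show ?thesis using infsum_nonneg[of UNIV "\<lambda>y. P x y * \<psi> y"] by (simp add: g_def P_nonneg nn)
    next
      case False
      have "2 * \<psi> x \<le> \<rho> * V x * \<psi> x"
        using order_trans[OF M mult_left_mono[OF B(2)[OF False]]] \<rho> nn by (intro mult_right_mono) auto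
      then show ?thesis using False by (simp add: g_def eigen)
    qed
  qed
qed

text \<open>The potential now sits inside the sum, so the argument runs through
  \<open>u = \<psi> / V\<close>. Off \<open>B\<close>, \<open>u\<close> is at most
  \<open>\<rho> / 2 * \<psi>\<close>; applying \<open>P\<close> and dividing by
  \<open>\<rho>\<close> leaves the remainder \<open>inverse \<rho> * P uB\<close>, integrable by the
  contraction.\<close>

lemma dual_eigenfunction_bounded_l1:
  assumes V_ge: "\<And>x. V x \<ge> v" and v: "v > 0" and confining: "confining V" and \<rho>: "\<rho> > 0"
    and \<psi>: "(\<lambda>x. (\<psi> x)\<^sup>2 * \<mu> x) summable_on UNIV" and nn: "\<And>x. \<psi> x \<ge> 0"
    and eigen: "\<And>x. (\<Sum>\<^sub>\<infinity>y. P x y * (\<psi> y / V y)) = \<rho> * \<psi> x"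
  shows "\<exists>b. \<forall>x. \<psi> x \<le> b" and "(\<lambda>x. \<psi> x * \<mu> x) summable_on UNIV"
    and "(\<lambda>y. P x y * (\<psi> y / V y)) summable_on UNIV"
proof -
  have V_pos: "V x > 0" for x using V_ge v less_le_trans by blast
  define u where "u x = \<psi> x / V x" for x
  have u_nn: "u x \<ge> 0" for x using nn V_pos by (simp add: u_def less_imp_le)
  have u: "(\<lambda>x. (u x)\<^sup>2 * \<mu> x) summable_on UNIV"
  proof (rule summable_on_comparison_test)
    show "(\<lambda>x. (1 / v)\<^sup>2 * ((\<psi> x)\<^sup>2 * \<mu> x)) summable_on UNIV"
      by (rule summable_on_cmult_right[OF \<psi>])
    fix x
    have "u x \<le> \<psi> x / v"
      unfolding u_def using V_ge v nn by (intro divide_left_mono) (auto simp: V_pos)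
    then have "(u x)\<^sup>2 \<le> (\<psi> x / v)\<^sup>2"
      by (rule power_mono) (rule u_nn)
    from mult_right_mono[OF this less_imp_le[OF \<mu>_pos[of x]]]
    show "(u x)\<^sup>2 * \<mu> x \<le> (1 / v)\<^sup>2 * ((\<psi> x)\<^sup>2 * \<mu> x)"
      by (simp add: power_divide)
  qed (use \<mu>_pos in \<open>simp add: less_imp_le\<close>)
  show "(\<lambda>y. P x y * (\<psi> y / V y)) summable_on UNIV"
    using l2_imp_bounded(1)[OF u u_nn] by (simp add: u_def)
  let ?c = "1 + k * (\<Sum>\<^sub>\<infinity>x. (u x)\<^sup>2 * \<mu> x)"
  have eigen_u: "(\<Sum>\<^sub>\<infinity>y. P x y * u y) = \<rho> * \<psi> x" for x
    using eigen[of x] by (simp add: u_def)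
  have "\<psi> x \<le> ?c / \<rho>" for x
    using l2_imp_bounded(2)[OF u u_nn, of x] \<rho> unfolding eigen_u by (simp add: pos_le_divide_eq mult.commute)
  then show "\<exists>b. \<forall>x. \<psi> x \<le> b" by blast
  obtain M B where M: "\<rho> * real M \<ge> 2" and B: "finite B" "\<And>x. x \<notin> B \<Longrightarrow> V x \<ge> real M"
    using confining_obtain[OF confining \<rho>] by blast
  have M_pos: "real M > 0" using M \<rho> by (cases "M = 0") auto
  define uB where "uB x = (if x \<in> B then u x else 0)" for x
  have uB_nn: "uB x \<ge> 0" for x by (simp add: uB_def u_nn)
  have uB: "(\<lambda>x. uB x * \<mu> x) summable_on UNIV"
    by (rule finite_nonzero_values_imp_summable_on, rule finite_subset[OF _ B(1)])
      (auto simp: uB_def split: if_splits)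
  note PuB = l1_contraction[OF uB uB_nn]
  let ?g = "\<lambda>x. inverse \<rho> * (\<Sum>\<^sub>\<infinity>y. P x y * uB y)"
  show "(\<lambda>x. \<psi> x * \<mu> x) summable_on UNIV"
  proof (rule l2_imp_l1[OF \<psi> nn])
    show "(\<lambda>x. ?g x * \<mu> x) summable_on UNIV"
      using summable_on_cmult_right[OF PuB(2), of "inverse \<rho>"] by (simp only: mult.assoc)
    show "?g x \<ge> 0" for x
      using \<rho> infsum_nonneg[of UNIV "\<lambda>y. P x y * uB y"] by (simp add: P_nonneg uB_nn)
    show "\<psi> x \<le> ?g x + (\<Sum>\<^sub>\<infinity>y. P x y * \<psi> y) / 2" for x
    proof -
      have s: "(\<lambda>y. \<rho> / 2 * (P x y * \<psi> y)) summable_on UNIV"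
        by (rule summable_on_cmult_right[OF l2_imp_bounded(1)[OF \<psi> nn]])
      have u_le: "u y \<le> uB y + \<rho> / 2 * \<psi> y" for y
      proof (cases "y \<in> B")
        case False
        have "2 * \<psi> y \<le> \<rho> * V y * \<psi> y"
          using order_trans[OF M mult_left_mono[OF B(2)[OF False]]] \<rho> nn by (intro mult_right_mono) auto
        then show ?thesis using False V_pos[of y] by (simp add: uB_def u_def field_simps)
      qed (use \<rho> nn in \<open>simp add: uB_def\<close>)
      have "\<rho> * \<psi> x \<le> (\<Sum>\<^sub>\<infinity>y. P x y * uB y + \<rho> / 2 * (P x y * \<psi> y))"
        unfolding eigen_u[symmetric]
      proof (rule infsum_mono[OF l2_imp_bounded(1)[OF u u_nn] summable_on_add[OF PuB(1) s]])
        show "P x y * u y \<le> P x y * uB y + \<rho> / 2 * (P x y * \<psi> y)" for y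
          using mult_left_mono[OF u_le[of y] P_nonneg[of x y]] by (simp add: algebra_simps)
      qed
      also have "\<dots> = (\<Sum>\<^sub>\<infinity>y. P x y * uB y) + \<rho> / 2 * (\<Sum>\<^sub>\<infinity>y. P x y * \<psi> y)"
        unfolding infsum_add[OF PuB(1) s] infsum_cmult_right' ..
      finally show ?thesis using \<rho> by (simp add: field_simps)
    qed
  qed
qed

end

section \<open>Both operators placed in the common setting\<close>

theorem proposition6p2:
  fixes P P' :: "'a \<Rightarrow> 'a \<Rightarrow> real"
    and \<mu> V \<phi> \<phi>' \<nu> m m' :: "'a \<Rightarrow> real"
    and \<rho> C :: real
    and \<kappa> :: "nat \<Rightarrow> real"
    and A :: "nat \<Rightarrow> 'a set"
    and n\<^sub>0 :: nat
  assumes X_countable: "countable (UNIV :: 'a set)"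
    and X_infinite: "infinite (UNIV :: 'a set)"
    and P_kernel: "subprob_kernel P"
    and P'_kernel: "subprob_kernel P'"
    and mu_pos: "\<And>x. \<mu> x > 0"
    and duality: "\<And>x y. \<mu> x * P x y = \<mu> y * P' y x"
    and V_potential: "potential V"
    and P_pos: "\<And>x y. P x y > 0"
    and C_ge_1: "C \<ge> 1"
    and P2_le: "\<And>x y. kernel_sq P x y \<le> C * P x y"
    and P_over_mu: "(SUP x. SUP y. ennreal (P x y / \<mu> y)) < \<infinity>"
    and V_confining: "confining V"
    and lambda0: "\<rho> = l2_spectral_radius \<mu> (fk_op P V)"
    and phi: "normalized_ground_state \<mu> (fk_op P V) \<rho> \<phi>"
    and phi': "normalized_ground_state \<mu> (fk_dual_op P' V) \<rho> \<phi>'"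
    and nu: "\<nu> = (\<lambda>x. \<phi> x * \<phi>' x * \<mu> x)"
    and m: "m = (\<lambda>x. \<phi>' x * \<mu> x / l1_norm \<mu> \<phi>')"
    and m': "m' = (\<lambda>x. \<phi> x * \<mu> x / l1_norm \<mu> \<phi>)"
    and kappa_nonneg: "\<And>n. n \<ge> 1 \<Longrightarrow> \<kappa> n \<ge> 0"
    and n0: "n\<^sub>0 \<ge> 1"
  shows
    "((\<exists>C\<^sub>1>0. \<forall>n\<ge>n\<^sub>0. sup_dev (A n) \<nu> (intrinsic_op (fk_op P V) \<rho> \<phi> n) (wmean \<nu>)
                        \<le> ennreal (C\<^sub>1 * \<kappa> n)) \<longrightarrow>
      (\<exists>C\<^sub>2>0. \<forall>n\<ge>n\<^sub>0. sup_dev (A n) m (normalized_op (fk_op P V) n) (wsum m)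
                        \<le> ennreal (C\<^sub>2 * \<kappa> n)))
     \<and>
     (\<forall>C\<^sub>2>0. (\<forall>n\<ge>n\<^sub>0. sup_dev (A n) m (normalized_op (fk_op P V) n) (wsum m)
                        \<le> ennreal (C\<^sub>2 * \<kappa> n)) \<and>
              (SUP n\<in>{n\<^sub>0..}. ennreal (C\<^sub>2 * \<kappa> n)) < 1 \<longrightarrow>
      (\<exists>C\<^sub>1>0. \<forall>n\<ge>n\<^sub>0. sup_dev (A n) \<nu> (intrinsic_op (fk_op P V) \<rho> \<phi> n) (wmean \<nu>)
                        \<le> ennreal (C\<^sub>1 * \<kappa> n)))
     \<and>
     ((\<exists>C\<^sub>1>0. \<forall>n\<ge>n\<^sub>0. sup_dev (A n) \<nu> (intrinsic_op (fk_dual_op P' V) \<rho> \<phi>' n) (wmean \<nu>)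
                        \<le> ennreal (C\<^sub>1 * \<kappa> n)) \<longrightarrow>
      (\<exists>C\<^sub>2>0. \<forall>n\<ge>n\<^sub>0. sup_dev (A n) m' (normalized_op (fk_dual_op P' V) n) (wsum m')
                        \<le> ennreal (C\<^sub>2 * \<kappa> n)))
     \<and>
     (\<forall>C\<^sub>2>0. (\<forall>n\<ge>n\<^sub>0. sup_dev (A n) m' (normalized_op (fk_dual_op P' V) n) (wsum m')
                        \<le> ennreal (C\<^sub>2 * \<kappa> n)) \<and>
              (SUP n\<in>{n\<^sub>0..}. ennreal (C\<^sub>2 * \<kappa> n)) < 1 \<longrightarrow>
      (\<exists>C\<^sub>1>0. \<forall>n\<ge>n\<^sub>0. sup_dev (A n) \<nu> (intrinsic_op (fk_dual_op P' V) \<rho> \<phi>' n) (wmean \<nu>)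
                        \<le> ennreal (C\<^sub>1 * \<kappa> n)))"
proof -
  obtain k where k: "P x y \<le> k * \<mu> y" for x y
  proof -
    define S where "S = (SUP x. SUP y. ennreal (P x y / \<mu> y))"
    obtain k where k: "k \<ge> 0" "S = ennreal k"
      using P_over_mu unfolding S_def[symmetric] by (cases S) auto
    have "ennreal (P x y / \<mu> y) \<le> ennreal k" for x y
      unfolding k(2)[symmetric] S_def by (rule SUP_upper2[of x], simp, rule SUP_upper2[of y], simp_all)
    then have "P x y / \<mu> y \<le> k" for x y using k(1) by simp
    then show thesis using that[of k] mu_pos by (simp add: pos_divide_le_eq)
  qed
  interpret P: dual_subprob_kernels P P' \<mu> k
    by unfold_locales (use P_kernel P'_kernel mu_pos duality k in auto)
  interpret P': dual_subprob_kernels P' P \<mu> k by (rule P.dual)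
  define v where "v = (INF x. V x)"
  have v: "v > 0" and V_pos: "V x > 0" for x
    using V_potential by (auto simp: potential_def v_def)
  \<comment> \<open>A real \<open>INF\<close> is a lower bound only for families bounded below;
    positivity of \<open>V\<close> provides the bound 0.\<close>
  have V_ge: "V x \<ge> v" for x
    unfolding v_def by (rule cINF_lower) (use V_pos less_imp_le in \<open>auto intro!: bdd_belowI2\<close>)
  have \<phi>_pos: "\<phi> x > 0" and \<phi>'_pos: "\<phi>' x > 0" for x
    using phi phi' by (auto simp: normalized_ground_state_def)
  note \<phi>_nn = less_imp_le[OF \<phi>_pos] and \<phi>'_nn = less_imp_le[OF \<phi>'_pos]
  have \<phi>_l2: "(\<lambda>x. (\<phi> x)\<^sup>2 * \<mu> x) summable_on UNIV"
    and \<phi>'_l2: "(\<lambda>x. (\<phi>' x)\<^sup>2 * \<mu> x) summable_on UNIV"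
    using phi phi' by (auto simp: normalized_ground_state_def l2_space_def)
  have eigen: "(\<Sum>\<^sub>\<infinity>y. P x y * \<phi> y) = \<rho> * V x * \<phi> x" for x
  proof -
    have "fk_op P V \<phi> x = \<rho> * \<phi> x" using phi by (simp add: normalized_ground_state_def)
    then show ?thesis using V_pos[of x] by (simp add: fk_op_def field_simps)
  qed
  have eigen': "(\<Sum>\<^sub>\<infinity>y. P' x y * (\<phi>' y / V y)) = \<rho> * \<phi>' x" for x
  proof -
    have "fk_dual_op P' V \<phi>' x = \<rho> * \<phi>' x" using phi' by (simp add: normalized_ground_state_def)
    then show ?thesis by (simp add: fk_dual_op_def)
  qed
  note P\<phi> = P.l2_imp_bounded(1)[OF \<phi>_l2 \<phi>_nn]
  \<comment> \<open>Read off the eigenvalue equation at an arbitrary point, where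
    \<open>P \<phi>\<close> is positive because \<open>P\<close> and \<open>\<phi>\<close>
    are.\<close>
  have \<rho>: "\<rho> > 0"
  proof -
    have "(\<Sum>\<^sub>\<infinity>y. P undefined y * \<phi> y) > 0"
      by (rule infsum_pos[OF P\<phi>]) (simp add: P_pos \<phi>_pos)
    then show ?thesis
      using eigen[of undefined] V_pos[of undefined] \<phi>_pos[of undefined] by (simp add: zero_less_mult_iff)
  qed
  note \<phi>_l1 = P.eigenfunction_bounded_l1[OF V_ge v V_confining \<rho> \<phi>_l2 \<phi>_nn eigen]
  note \<phi>'_l1 = P'.dual_eigenfunction_bounded_l1[OF V_ge v V_confining \<rho> \<phi>'_l2 \<phi>'_nn eigen']
  obtain b where b: "\<And>x. \<phi> x \<le> b" using \<phi>_l1(1) by blast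
  obtain b' where b': "\<And>x. \<phi>' x \<le> b'" using \<phi>'_l1(1) by blast
  let ?K = "\<lambda>x y. P x y / V x" and ?K' = "\<lambda>x y. P' x y / V y"
  have K: "((\<lambda>y. ?K x y * \<phi> y) has_sum \<rho> * \<phi> x) UNIV" for x
    using has_sum_cmult_right[OF has_sum_infsum[OF P\<phi>[of x]], of "inverse (V x)"] V_pos[of x]
    unfolding eigen by (simp add: field_simps)
  have K': "((\<lambda>y. ?K' x y * \<phi>' y) has_sum \<rho> * \<phi>' x) UNIV" for x
    using has_sum_infsum[OF \<phi>'_l1(3)[of x]] unfolding eigen' by simp
  \<comment> \<open>Duality turns the left eigenvalue equation for \<open>\<phi>' * \<mu>\<close>
    into \<open>\<mu> y\<close> times the right one for \<open>\<phi>'\<close> and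
    \<open>?K'\<close>.\<close>
  interpret U: kernel_ground_state ?K \<phi> "\<lambda>x. \<phi>' x * \<mu> x" \<rho> b
  proof
    show "((\<lambda>x. \<phi>' x * \<mu> x * ?K x y) has_sum \<rho> * (\<phi>' y * \<mu> y)) UNIV" for y
    proof -
      have eq: "\<phi>' x * \<mu> x * ?K x y = \<mu> y * (?K' y x * \<phi>' x)" for x
        using duality[of x y] by (simp add: mult_ac)
      show ?thesis
        unfolding eq using has_sum_cmult_right[OF K'[of y], of "\<mu> y"] by (simp add: mult_ac)
    qed
  qed (use P.P_nonneg V_pos \<phi>_pos \<phi>'_pos mu_pos \<rho> b \<phi>'_l1(2) K in \<open>auto simp: less_imp_le\<close>)
  \<comment> \<open>The same with the roles of the two ground states exchanged; this yields the
    hatted statements.\<close>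
  interpret U': kernel_ground_state ?K' \<phi>' "\<lambda>x. \<phi> x * \<mu> x" \<rho> b'
  proof
    show "((\<lambda>x. \<phi> x * \<mu> x * ?K' x y) has_sum \<rho> * (\<phi> y * \<mu> y)) UNIV" for y
    proof -
      have eq: "\<phi> x * \<mu> x * ?K' x y = \<mu> y * (?K y x * \<phi> x)" for x
        using duality[of y x] by (simp add: mult_ac)
      show ?thesis
        unfolding eq using has_sum_cmult_right[OF K[of y], of "\<mu> y"] by (simp add: mult_ac)
    qed
  qed (use P.P'_nonneg V_pos \<phi>_pos \<phi>'_pos mu_pos \<rho> b' \<phi>_l1(2) K' in \<open>auto simp: less_imp_le\<close>)
  have ops: "fk_op P V = kernel_op ?K" "fk_dual_op P' V = kernel_op ?K'"
    by (rule ext, rule fk_op_eq_kernel_op, rule ext, rule fk_dual_op_eq_kernel_op)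
  have weights: "m = (\<lambda>x. \<phi>' x * \<mu> x / U.mass)" "m' = (\<lambda>x. \<phi> x * \<mu> x / U'.mass)"
    unfolding m m' l1_norm_def U.mass_def U'.mass_def using \<phi>_nn \<phi>'_nn by simp_all
  \<comment> \<open>Two groupings of the same measure: each setting separates its own ground state
    from its weight \<open>w\<close>.\<close>
  have \<nu>: "\<nu> = (\<lambda>x. \<phi> x * (\<phi>' x * \<mu> x))" and \<nu>': "\<nu> = (\<lambda>x. \<phi>' x * (\<phi> x * \<mu> x))"
    unfolding nu by (simp_all add: mult_ac)
  have \<kappa>: "\<kappa> n \<ge> 0" if "n \<ge> n\<^sub>0" for n
    using kappa_nonneg n0 that by simp
  note U.normalized_rate_if_intrinsic_rate[where N = n\<^sub>0 and \<kappa> = \<kappa> and A = A, OF \<kappa>, folded ops weights \<nu>]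
    U.intrinsic_rate_if_normalized_rate[where N = n\<^sub>0 and \<kappa> = \<kappa> and A = A, OF \<kappa>, folded ops weights \<nu>]
    U'.normalized_rate_if_intrinsic_rate[where N = n\<^sub>0 and \<kappa> = \<kappa> and A = A, OF \<kappa>, folded ops weights \<nu>']
    U'.intrinsic_rate_if_normalized_rate[where N = n\<^sub>0 and \<kappa> = \<kappa> and A = A, OF \<kappa>, folded ops weights \<nu>']
  then show ?thesis by blast
qed

end
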